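(* The states functor $S_{(-)}=\mathbf{EMod}(-,[0,1]):\mathbf{EMod}^{\mathrm{op}}\to\mathrm{Alg}(\mathcal{E})$ has a left adjoint, given by homming into $[0,1]$, namely $\mathrm{Alg}(\mathcal{E})(-,[0,1]):\mathrm{Alg}(\mathcal{E})\to\mathbf{EMod}^{\mathrm{op}}$.
   Context: Effect algebra: a set $E$ with a partial commutative associative operation $\oplus$ with neutral element $0$ and a map $(-)^\perp$ such that, with $1:=0^\perp$, $x^\perp$ is the unique element with $x\oplus x^\perp=1$, and $x\oplus 1$ is defined only if $x=0$. Effect module: an effect algebra with scalar multiplication $[0,1]\times E\to E$ with $1x=x$, $(rs)x=r(sx)$, $(r+s)x=rx\oplus sx$ if $r+s\le1$, and $r(x\oplus y)=rx\oplus ry$ if $x\oplus y$ is defined. Category $\mathbf{EMod}$: maps preserve $1$, defined sums $\oplus$, and scalar multiplication. $[0,1]^X$ is an effect module pointwise. Expectation monad on $\mathbf{Sets}$: $\mathcal{E}(X)=\mathbf{EMod}([0,1]^X,[0,1])$, $\mathcal{E}(f)(h)(p)=h(p\circ f)$, unit $\eta(x)(p)=p(x)$, multiplication $\mu(h)(p)=h(\lambda k\in\mathcal{E}(X).\,k(p))$. $\mathrm{Alg}(\mathcal{E})$ is its category of Eilenberg-Moore algebras. For an effect module $M$, the set $S_M=\mathbf{EMod}(M,[0,1])$ carries the $\mathcal{E}$-algebra structure $\alpha_M:\mathcal{E}(S_M)\to S_M$, $\alpha_M(h)(y)=h(\lambda k\in S_M.\,k(y))$. The interval $[0,1]$ carries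 the $\mathcal{E}$-algebra structure $h\mapsto h(\mathrm{id}_{[0,1]})$. For an $\mathcal{E}$-algebra $\alpha:\mathcal{E}(X)\to X$, $\mathrm{Alg}(\mathcal{E})(\alpha,[0,1])$ is the set of algebra homomorphisms $X\to[0,1]$, with the effect module structure inherited from $[0,1]^X$ (pointwise). Both functors act on morphisms by precomposition. *)

theory Defs
  imports Complex_Main "HOL-Library.FuncSet"
begin

section \<open>Effect algebras and effect modules\<close>

text \<open>
  Sets are rendered as carrier sets, and maps between them as extensional functions
  (\<open>A \<rightarrow>\<^sub>E B\<close>), so that equality of maps is equality in HOL.
  The partial sum is option-valued: \<open>osum E x y = None\<close> means that \<open>x \<oplus> y\<close> is undefined.
\<close>

record 'a effect_alg =
  carrier :: "'a set"
  osum :: "'a \<Rightarrow> 'a \<Rightarrow> 'a option"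
  ezero :: 'a
  orth :: "'a \<Rightarrow> 'a"

record 'a effect_mod = "'a effect_alg" +
  scale :: "real \<Rightarrow> 'a \<Rightarrow> 'a"

definition eone :: "('a, 'b) effect_alg_scheme \<Rightarrow> 'a" where
  "eone E = orth E (ezero E)"

text \<open>
  In \<open>assoc\<close>, equality in the option type means that either side is defined
  iff the other one is, and that then both have the same value.
\<close>

locale effect_algebra =
  fixes E :: "('a, 'b) effect_alg_scheme"
  assumes zero_closed: "ezero E \<in> carrier E"
    and orth_closed: "x \<in> carrier E \<Longrightarrow> orth E x \<in> carrier E"
    and osum_closed:
      "\<lbrakk>x \<in> carrier E; y \<in> carrier E; osum E x y = Some z\<rbrakk> \<Longrightarrow> z \<in> carrier E"
    and commute: "\<lbrakk>x \<in> carrier E; y \<in> carrier E\<rbrakk> \<Longrightarrow> osum E x y = osum E y x"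
    and assoc:
      "\<lbrakk>x \<in> carrier E; y \<in> carrier E; z \<in> carrier E\<rbrakk> \<Longrightarrow>
        Option.bind (osum E x y) (\<lambda>w. osum E w z) = Option.bind (osum E y z) (\<lambda>w. osum E x w)"
    and zero_osum: "x \<in> carrier E \<Longrightarrow> osum E (ezero E) x = Some x"
    and osum_orth: "x \<in> carrier E \<Longrightarrow> osum E x (orth E x) = Some (eone E)"
    and orth_unique:
      "\<lbrakk>x \<in> carrier E; y \<in> carrier E; osum E x y = Some (eone E)\<rbrakk> \<Longrightarrow> y = orth E x"
    and osum_one_defined:
      "\<lbrakk>x \<in> carrier E; osum E x (eone E) \<noteq> None\<rbrakk> \<Longrightarrow> x = ezero E"

locale effect_module = effect_algebra E
  for E :: "('a, 'b) effect_mod_scheme" +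
  assumes scale_closed: "\<lbrakk>r \<in> {0..1}; x \<in> carrier E\<rbrakk> \<Longrightarrow> scale E r x \<in> carrier E"
    and scale_one: "x \<in> carrier E \<Longrightarrow> scale E 1 x = x"
    and scale_mult:
      "\<lbrakk>r \<in> {0..1}; s \<in> {0..1}; x \<in> carrier E\<rbrakk> \<Longrightarrow> scale E (r * s) x = scale E r (scale E s x)"
    and scale_add:
      "\<lbrakk>r \<in> {0..1}; s \<in> {0..1}; r + s \<le> 1; x \<in> carrier E\<rbrakk> \<Longrightarrow>
        osum E (scale E r x) (scale E s x) = Some (scale E (r + s) x)"
    and scale_osum:
      "\<lbrakk>r \<in> {0..1}; x \<in> carrier E; y \<in> carrier E; osum E x y = Some z\<rbrakk> \<Longrightarrow>
        osum E (scale E r x) (scale E r y) = Some (scale E r z)"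

definition emod_hom :: "'a effect_mod \<Rightarrow> 'b effect_mod \<Rightarrow> ('a \<Rightarrow> 'b) set" where
  "emod_hom M N = {f \<in> carrier M \<rightarrow>\<^sub>E carrier N.
     f (eone M) = eone N \<and>
     (\<forall>x\<in>carrier M. \<forall>y\<in>carrier M. \<forall>z. osum M x y = Some z \<longrightarrow> osum N (f x) (f y) = Some (f z)) \<and>
     (\<forall>r\<in>{0..1}. \<forall>x\<in>carrier M. f (scale M r x) = scale N r (f x))}"

definition unit_interval :: "real effect_mod" where
  "unit_interval =
     \<lparr>carrier = {0..1},
      osum = (\<lambda>x y. if x + y \<le> 1 then Some (x + y) else None),
      ezero = 0,
      orth = (\<lambda>x. 1 - x),
      scale = (\<lambda>r x. r * x)\<rparr>"

definition power_module :: "'x set \<Rightarrow> ('x \<Rightarrow> real) effect_mod" where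
  "power_module X =
     \<lparr>carrier = X \<rightarrow>\<^sub>E {0..1},
      osum = (\<lambda>p q. if \<forall>x\<in>X. p x + q x \<le> 1 then Some (\<lambda>x\<in>X. p x + q x) else None),
      ezero = (\<lambda>x\<in>X. 0),
      orth = (\<lambda>p. \<lambda>x\<in>X. 1 - p x),
      scale = (\<lambda>r p. \<lambda>x\<in>X. r * p x)\<rparr>"

section \<open>The expectation monad and its Eilenberg-Moore algebras\<close>

definition expect :: "'x set \<Rightarrow> (('x \<Rightarrow> real) \<Rightarrow> real) set" where
  "expect X = emod_hom (power_module X) unit_interval"

definition expect_map ::
  "'x set \<Rightarrow> 'y set \<Rightarrow> ('x \<Rightarrow> 'y) \<Rightarrow> (('x \<Rightarrow> real) \<Rightarrow> real) \<Rightarrow> (('y \<Rightarrow> real) \<Rightarrow> real)" where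
  "expect_map X Y f = (\<lambda>h\<in>expect X. \<lambda>p\<in>Y \<rightarrow>\<^sub>E {0..1}. h (compose X p f))"

definition expect_unit :: "'x set \<Rightarrow> 'x \<Rightarrow> (('x \<Rightarrow> real) \<Rightarrow> real)" where
  "expect_unit X = (\<lambda>x\<in>X. \<lambda>p\<in>X \<rightarrow>\<^sub>E {0..1}. p x)"

definition expect_mult ::
  "'x set \<Rightarrow> (((('x \<Rightarrow> real) \<Rightarrow> real) \<Rightarrow> real) \<Rightarrow> real) \<Rightarrow> (('x \<Rightarrow> real) \<Rightarrow> real)" where
  "expect_mult X = (\<lambda>h\<in>expect (expect X). \<lambda>p\<in>X \<rightarrow>\<^sub>E {0..1}. h (\<lambda>k\<in>expect X. k p))"

record 'x expect_alg =
  points :: "'x set"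
  act :: "(('x \<Rightarrow> real) \<Rightarrow> real) \<Rightarrow> 'x"

locale expectation_algebra =
  fixes A :: "('x, 'b) expect_alg_scheme"
  assumes act_closed: "act A \<in> expect (points A) \<rightarrow>\<^sub>E points A"
    and act_unit: "x \<in> points A \<Longrightarrow> act A (expect_unit (points A) x) = x"
    and act_mult: "h \<in> expect (expect (points A)) \<Longrightarrow>
      act A (expect_map (expect (points A)) (points A) (act A) h)
        = act A (expect_mult (points A) h)"

definition alg_hom :: "'x expect_alg \<Rightarrow> 'y expect_alg \<Rightarrow> ('x \<Rightarrow> 'y) set" where
  "alg_hom A B = {f \<in> points A \<rightarrow>\<^sub>E points B.
     \<forall>h\<in>expect (points A). f (act A h) = act B (expect_map (points A) (points B) f h)}"

section \<open>The two functors and transposition\<close>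

definition states :: "'m effect_mod \<Rightarrow> ('m \<Rightarrow> real) expect_alg" where
  "states M =
     (let S = emod_hom M unit_interval
      in \<lparr>points = S, act = (\<lambda>h\<in>expect S. \<lambda>y\<in>carrier M. h (\<lambda>k\<in>S. k y))\<rparr>)"

definition interval_alg :: "real expect_alg" where
  "interval_alg = \<lparr>points = {0..1}, act = (\<lambda>h\<in>expect {0..1}. h (\<lambda>x\<in>{0..1}. x))\<rparr>"

definition predicates :: "'x expect_alg \<Rightarrow> ('x \<Rightarrow> real) effect_mod" where
  "predicates A = (power_module (points A))\<lparr>carrier := alg_hom A interval_alg\<rparr>"

definition states_map ::
  "'m effect_mod \<Rightarrow> 'n effect_mod \<Rightarrow> ('m \<Rightarrow> 'n) \<Rightarrow> ('n \<Rightarrow> real) \<Rightarrow> ('m \<Rightarrow> real)" where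
  "states_map M N g = (\<lambda>k\<in>emod_hom N unit_interval. compose (carrier M) k g)"

definition predicates_map ::
  "'x expect_alg \<Rightarrow> 'y expect_alg \<Rightarrow> ('x \<Rightarrow> 'y) \<Rightarrow> ('y \<Rightarrow> real) \<Rightarrow> ('x \<Rightarrow> real)" where
  "predicates_map A B f = (\<lambda>p\<in>alg_hom B interval_alg. compose (points A) p f)"

text \<open>
  Arrows of the opposite category are reversed, so an arrow from \<open>predicates A\<close> to \<open>M\<close>
  in the opposite of EMod is an element of \<open>emod_hom M (predicates A)\<close>; transposition takes it
  to \<open>alg_hom A (states M)\<close>. Both functors change the underlying HOL type, so no single type
  contains all objects. The natural family of bijections is therefore given as a polymorphic
  constant rather than asserted by an existential quantifier, which would fix the types.
\<close>

definition adj_transpose ::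
  "'x expect_alg \<Rightarrow> 'm effect_mod \<Rightarrow> ('m \<Rightarrow> 'x \<Rightarrow> real) \<Rightarrow> ('x \<Rightarrow> 'm \<Rightarrow> real)" where
  "adj_transpose A M \<phi> = (\<lambda>x\<in>points A. \<lambda>y\<in>carrier M. \<phi> y x)"

end

theory Submission
  imports Defs
begin

text \<open>
  Evaluating the algebra structure of the interval shows that a map \<open>p : X \<rightarrow> [0,1]\<close> is an
  algebra homomorphism iff \<open>p (\<alpha> h) = h p\<close> for all \<open>h\<close>. As every \<open>h\<close> preserves the effect module
  operations, these \<open>p\<close> form a submodule of \<open>[0,1]\<^sup>X\<close>. A map
  \<open>\<psi> : X \<rightarrow> S\<^sub>M\<close> is an algebra homomorphism iff \<open>\<psi> (\<alpha> h) y = h (\<lambda>x. \<psi> x y)\<close> for all \<open>h\<close>, \<open>y\<close>,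
  which says that every \<open>\<lambda>x. \<psi> x y\<close> is a homomorphism into the interval; hence
  swapping the two arguments is a bijection.
\<close>

section \<open>Homomorphisms of effect modules\<close>

lemma unit_interval_simps [simp]:
  "carrier unit_interval = {0..1}"
  "osum unit_interval x y = (if x + y \<le> 1 then Some (x + y) else None)"
  "ezero unit_interval = 0"
  "orth unit_interval x = 1 - x"
  "eone unit_interval = 1"
  "scale unit_interval r x = r * x"
  by (simp_all add: unit_interval_def eone_def)

lemma power_module_simps [simp]:
  "carrier (power_module X) = X \<rightarrow>\<^sub>E {0..1}"
  "osum (power_module X) p q =
    (if \<forall>x\<in>X. p x + q x \<le> 1 then Some (\<lambda>x\<in>X. p x + q x) else None)"
  "ezero (power_module X) = (\<lambda>x\<in>X. 0)"
  "orth (power_module X) p = (\<lambda>x\<in>X. 1 - p x)"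
  "eone (power_module X) = (\<lambda>x\<in>X. 1)"
  "scale (power_module X) r p = (\<lambda>x\<in>X. r * p x)"
  by (auto simp: power_module_def eone_def)

lemma emod_homI:
  assumes "f \<in> carrier M \<rightarrow>\<^sub>E carrier N"
    and "f (eone M) = eone N"
    and "\<And>x y z. \<lbrakk>x \<in> carrier M; y \<in> carrier M; osum M x y = Some z\<rbrakk> \<Longrightarrow>
      osum N (f x) (f y) = Some (f z)"
    and "\<And>r x. \<lbrakk>r \<in> {0..1}; x \<in> carrier M\<rbrakk> \<Longrightarrow> f (scale M r x) = scale N r (f x)"
  shows "f \<in> emod_hom M N"
  using assms by (auto simp: emod_hom_def)

lemma emod_homD:
  assumes "f \<in> emod_hom M N"
  shows emod_hom_fun: "f \<in> carrier M \<rightarrow>\<^sub>E carrier N"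
    and emod_hom_closed: "x \<in> carrier M \<Longrightarrow> f x \<in> carrier N"
    and emod_hom_one: "f (eone M) = eone N"
    and emod_hom_osum: "\<lbrakk>x \<in> carrier M; y \<in> carrier M; osum M x y = Some z\<rbrakk> \<Longrightarrow>
      osum N (f x) (f y) = Some (f z)"
    and emod_hom_scale: "\<lbrakk>r \<in> {0..1}; x \<in> carrier M\<rbrakk> \<Longrightarrow> f (scale M r x) = scale N r (f x)"
  using assms by (auto simp: emod_hom_def)

lemma (in effect_algebra) one_closed: "eone E \<in> carrier E"
  by (simp add: eone_def orth_closed zero_closed)

text \<open>\<open>compose\<close> is cut off outside \<open>carrier M\<close>, so it can be
  evaluated at the unit, at sums and at scalar multiples only once these lie in
  \<open>carrier M\<close>; the module axioms of \<open>M\<close> supply this.\<close>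

lemma emod_hom_compose:
  assumes M: "effect_module M" and f: "f \<in> emod_hom M N" and g: "g \<in> emod_hom N K"
  shows "compose (carrier M) g f \<in> emod_hom M K"
proof (rule emod_homI)
  interpret effect_module M by (rule M)
  show "compose (carrier M) g f \<in> carrier M \<rightarrow>\<^sub>E carrier K"
    by (auto simp: compose_def emod_hom_closed[OF f] emod_hom_closed[OF g])
  show "compose (carrier M) g f (eone M) = eone K"
    by (simp add: compose_eq one_closed emod_hom_one[OF f] emod_hom_one[OF g])
  show "osum K (compose (carrier M) g f x) (compose (carrier M) g f y) =
      Some (compose (carrier M) g f z)"
    if "x \<in> carrier M" "y \<in> carrier M" "osum M x y = Some z" for x y z
    using that osum_closed[OF that]
    by (simp add: compose_eq emod_hom_closed[OF f] emod_hom_osum[OF f] emod_hom_osum[OF g])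
  show "compose (carrier M) g f (scale M r x) = scale K r (compose (carrier M) g f x)"
    if "r \<in> {0..1}" "x \<in> carrier M" for r x
    using that scale_closed[OF that]
    by (simp add: compose_eq emod_hom_closed[OF f] emod_hom_scale[OF f] emod_hom_scale[OF g])
qed

text \<open>The axioms are inherited pointwise from the real interval, so closure of
  \<open>P\<close> is all that has to be checked. It serves both for the full function space and for
  the homomorphisms into the interval.\<close>

lemma effect_module_pointwise:
  assumes sub: "P \<subseteq> X \<rightarrow>\<^sub>E {0..1}"
    and zero: "(\<lambda>x\<in>X. 0) \<in> P"
    and orth: "\<And>p. p \<in> P \<Longrightarrow> (\<lambda>x\<in>X. 1 - p x) \<in> P"
    and add: "\<And>p q. \<lbrakk>p \<in> P; q \<in> P; \<forall>x\<in>X. p x + q x \<le> 1\<rbrakk> \<Longrightarrow> (\<lambda>x\<in>X. p x + q x) \<in> P"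
    and scale: "\<And>r p. \<lbrakk>r \<in> {0..1}; p \<in> P\<rbrakk> \<Longrightarrow> (\<lambda>x\<in>X. r * p x) \<in> P"
  shows "effect_module ((power_module X)\<lparr>carrier := P\<rparr>)" (is "effect_module ?E")
proof -
  have range: "0 \<le> p x" "p x \<le> 1" if "p \<in> P" "x \<in> X" for p x
    using sub that by (auto simp: PiE_iff)
  have ext: "p = q" if "p \<in> P" "q \<in> P" "\<And>x. x \<in> X \<Longrightarrow> p x = q x" for p q
    using that by (intro PiE_ext[of p X "\<lambda>_. {0..1}" q] subsetD[OF sub])
  \<comment> \<open>The record update replaces the carrier alone, so the operations are computed by
    the rules for \<open>power_module\<close>.\<close>
  have ops [simp]: "osum ?E = osum (power_module X)" "ezero ?E = ezero (power_module X)"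
    "orth ?E = orth (power_module X)" "scale ?E = scale (power_module X)"
    "eone ?E = eone (power_module X)"
    by (simp_all add: eone_def)
  show ?thesis
  proof
    fix p q r assume "p \<in> carrier ?E" "q \<in> carrier ?E" "r \<in> carrier ?E"
    then have P: "p \<in> P" "q \<in> P" "r \<in> P" by simp_all
    \<comment> \<open>Both bracketings are defined exactly if the total is at most 1: the partial
      sum \<open>p + q\<close> is bounded by the total because \<open>r\<close> is nonnegative, and
      \<open>q + r\<close> because \<open>p\<close> is.\<close>
    have "(\<forall>x\<in>X. p x + q x \<le> 1) \<and> (\<forall>x\<in>X. p x + q x + r x \<le> 1) \<longleftrightarrow>
        (\<forall>x\<in>X. q x + r x \<le> 1) \<and> (\<forall>x\<in>X. p x + (q x + r x) \<le> 1)"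
      using range[OF P(1)] range[OF P(3)] by fastforce
    then show "Option.bind (osum ?E p q) (\<lambda>w. osum ?E w r) =
        Option.bind (osum ?E q r) (\<lambda>w. osum ?E p w)"
      by (auto simp: add.assoc fun_eq_iff restrict_def)
  next
    fix p assume "p \<in> carrier ?E"
    then have P: "p \<in> P" by simp
    then have restr: "(\<lambda>x\<in>X. p x) = p"
      using sub by (auto simp: PiE_iff extensional_restrict)
    then show "osum ?E (ezero ?E) p = Some p" "scale ?E 1 p = p"
      using range[OF P] by (simp_all cong: restrict_cong)
  next
    fix p q assume "p \<in> carrier ?E" "q \<in> carrier ?E" "osum ?E p q = Some (eone ?E)"
    then have P: "p \<in> P" "q \<in> P" and sum: "\<And>x. x \<in> X \<Longrightarrow> p x + q x = 1"
      by (auto split: if_splits dest!: fun_cong)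
    show "q = orth ?E p"
      using P orth sum by (intro ext) (auto simp: algebra_simps)
  next
    fix p assume "p \<in> carrier ?E" "osum ?E p (eone ?E) \<noteq> None"
    then have P: "p \<in> P" and le: "\<And>x. x \<in> X \<Longrightarrow> p x + 1 \<le> 1"
      by (auto split: if_splits)
    show "p = ezero ?E"
      using P zero le range[OF P] by (intro ext) force+
  next
    fix r s :: real and p assume "r \<in> {0..1}" "s \<in> {0..1}" "r + s \<le> 1" "p \<in> carrier ?E"
    then have "\<forall>x\<in>X. r * p x + s * p x \<le> 1"
      using range by (auto simp: distrib_right[symmetric] intro!: mult_le_one)
    then show "osum ?E (scale ?E r p) (scale ?E s p) = Some (scale ?E (r + s) p)"
      by (auto simp: distrib_right fun_eq_iff)
  next
    fix r :: real and p q z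
    assume "r \<in> {0..1}" "p \<in> carrier ?E" "q \<in> carrier ?E" "osum ?E p q = Some z"
    then have r: "r \<in> {0..1}" and P: "p \<in> P" "q \<in> P" and le: "\<forall>x\<in>X. p x + q x \<le> 1"
      and z: "z = (\<lambda>x\<in>X. p x + q x)"
      by (auto split: if_splits)
    have "\<forall>x\<in>X. r * p x + r * q x \<le> 1"
      using r le range P by (auto simp: distrib_left[symmetric] intro!: mult_le_one add_nonneg_nonneg)
    then show "osum ?E (scale ?E r p) (scale ?E r q) = Some (scale ?E r z)"
      by (auto simp: z distrib_left fun_eq_iff)
  next
    fix p q z assume "p \<in> carrier ?E" "q \<in> carrier ?E" "osum ?E p q = Some z"
    then show "z \<in> carrier ?E"
      using add by (auto split: if_splits)
  qed (use zero orth add scale in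
    \<open>auto simp: add.commute mult.assoc fun_eq_iff restrict_def split: if_splits\<close>)
qed

lemma effect_module_power_module: "effect_module (power_module X)"
proof -
  have "effect_module ((power_module X)\<lparr>carrier := X \<rightarrow>\<^sub>E {0..1}\<rparr>)"
    by (rule effect_module_pointwise) (auto simp: PiE_iff intro: mult_le_one)
  then show ?thesis
    by (simp add: power_module_def)
qed

section \<open>The expectation monad\<close>

text \<open>Evaluation at a point preserves pointwise operations. The unit laws need this
  membership, since the structure maps of the interval and of \<open>states M\<close> can be
  evaluated only on \<open>expect\<close>.\<close>

lemma expect_unit_closed:
  assumes "x \<in> X"
  shows "expect_unit X x \<in> expect X"
  unfolding expect_def
proof (rule emod_homI)
  interpret effect_module "power_module X" by (rule effect_module_power_module)
  show "expect_unit X x (eone (power_module X)) = eone unit_interval"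
    using assms one_closed by (simp add: expect_unit_def)
  show "osum unit_interval (expect_unit X x p) (expect_unit X x q) = Some (expect_unit X x z)"
    if "p \<in> carrier (power_module X)" "q \<in> carrier (power_module X)"
      "osum (power_module X) p q = Some z" for p q z
    using assms that osum_closed[OF that] by (auto simp: expect_unit_def split: if_splits)
  show "expect_unit X x (scale (power_module X) r p) = scale unit_interval r (expect_unit X x p)"
    if "r \<in> {0..1}" "p \<in> carrier (power_module X)" for r p
    using assms that scale_closed[OF that] by (simp add: expect_unit_def)
qed (use assms in \<open>auto simp: expect_unit_def\<close>)

text \<open>An element of \<open>expect X\<close> acts like integration against a finitely additive
  probability measure on \<open>X\<close>; with real addition in place of the partial sum, later
  computations are ordinary arithmetic.\<close>

lemma
  assumes "h \<in> expect X"
  shows expect_range: "p \<in> X \<rightarrow>\<^sub>E {0..1} \<Longrightarrow> h p \<in> {0..1}"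
    and expect_add: "\<lbrakk>p \<in> X \<rightarrow>\<^sub>E {0..1}; q \<in> X \<rightarrow>\<^sub>E {0..1}; \<forall>x\<in>X. p x + q x \<le> 1\<rbrakk> \<Longrightarrow>
      h (\<lambda>x\<in>X. p x + q x) = h p + h q"
    and expect_scale: "\<lbrakk>r \<in> {0..1}; p \<in> X \<rightarrow>\<^sub>E {0..1}\<rbrakk> \<Longrightarrow> h (\<lambda>x\<in>X. r * p x) = r * h p"
    and expect_one: "h (\<lambda>x\<in>X. 1) = 1"
proof -
  have h: "h \<in> emod_hom (power_module X) unit_interval"
    using assms by (simp add: expect_def)
  show "p \<in> X \<rightarrow>\<^sub>E {0..1} \<Longrightarrow> h p \<in> {0..1}"
    using emod_hom_closed[OF h] by simp
  show "\<lbrakk>r \<in> {0..1}; p \<in> X \<rightarrow>\<^sub>E {0..1}\<rbrakk> \<Longrightarrow> h (\<lambda>x\<in>X. r * p x) = r * h p"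
    using emod_hom_scale[OF h] by simp
  show "h (\<lambda>x\<in>X. 1) = 1"
    using emod_hom_one[OF h] by simp
  show "h (\<lambda>x\<in>X. p x + q x) = h p + h q"
    if "p \<in> X \<rightarrow>\<^sub>E {0..1}" "q \<in> X \<rightarrow>\<^sub>E {0..1}" "\<forall>x\<in>X. p x + q x \<le> 1"
    using emod_hom_osum[OF h, of p q "\<lambda>x\<in>X. p x + q x"] that by (simp split: if_splits)
qed

text \<open>Preservation of zero comes from scaling by 0.\<close>

lemma expect_zero:
  assumes "h \<in> expect X"
  shows "h (\<lambda>x\<in>X. 0) = 0"
  using expect_scale[OF assms, of 0 "\<lambda>x\<in>X. 0"] by (simp cong: restrict_cong)

text \<open>The sum of \<open>p\<close> and its complement is the constant 1, which \<open>h\<close>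
  sends to 1.\<close>

lemma expect_orth:
  assumes h: "h \<in> expect X" and p: "p \<in> X \<rightarrow>\<^sub>E {0..1}"
  shows "h (\<lambda>x\<in>X. 1 - p x) = 1 - h p"
proof -
  have "h (\<lambda>x\<in>X. p x + (\<lambda>x\<in>X. 1 - p x) x) = h p + h (\<lambda>x\<in>X. 1 - p x)"
    using p by (intro expect_add[OF h]) (auto dest: PiE_mem)
  then show ?thesis
    using expect_one[OF h] by (simp cong: restrict_cong)
qed

text \<open>Precomposition with \<open>f\<close> is a homomorphism from
  \<open>power_module Y\<close> to \<open>power_module X\<close>, and
  \<open>expect_map X Y f h\<close> is \<open>h\<close> after it.\<close>

lemma expect_map_closed:
  assumes f: "f \<in> X \<rightarrow> Y" and h: "h \<in> expect X"
  shows "expect_map X Y f h \<in> expect Y"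
proof -
  interpret effect_module "power_module Y" by (rule effect_module_power_module)
  have "(\<lambda>p\<in>Y \<rightarrow>\<^sub>E {0..1}. compose X p f) \<in> emod_hom (power_module Y) (power_module X)"
  proof (rule emod_homI)
    show "(\<lambda>p\<in>Y \<rightarrow>\<^sub>E {0..1}. compose X p f) (eone (power_module Y)) = eone (power_module X)"
      using f one_closed by (auto simp: compose_def fun_eq_iff)
    show "osum (power_module X) ((\<lambda>p\<in>Y \<rightarrow>\<^sub>E {0..1}. compose X p f) p)
        ((\<lambda>p\<in>Y \<rightarrow>\<^sub>E {0..1}. compose X p f) q) = Some ((\<lambda>p\<in>Y \<rightarrow>\<^sub>E {0..1}. compose X p f) z)"
      if "p \<in> carrier (power_module Y)" "q \<in> carrier (power_module Y)"
        "osum (power_module Y) p q = Some z" for p q z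
      using f that osum_closed[OF that]
      by (auto simp: compose_def fun_eq_iff Pi_iff split: if_splits)
    show "(\<lambda>p\<in>Y \<rightarrow>\<^sub>E {0..1}. compose X p f) (scale (power_module Y) r p) =
        scale (power_module X) r ((\<lambda>p\<in>Y \<rightarrow>\<^sub>E {0..1}. compose X p f) p)"
      if "r \<in> {0..1}" "p \<in> carrier (power_module Y)" for r p
      using f that scale_closed[OF that] by (auto simp: compose_def fun_eq_iff Pi_iff)
  qed (use f in \<open>auto simp: compose_def PiE_iff Pi_iff\<close>)
  from emod_hom_compose[OF effect_module_power_module this h[unfolded expect_def]]
  show ?thesis
    using h by (simp add: expect_def expect_map_def compose_def cong: restrict_cong)
qed

lemma expect_map_apply:
  "\<lbrakk>h \<in> expect X; p \<in> Y \<rightarrow>\<^sub>E {0..1}\<rbrakk> \<Longrightarrow> expect_map X Y f h p = h (compose X p f)"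
  by (simp add: expect_map_def)

lemma expect_mult_apply:
  "\<lbrakk>h \<in> expect (expect X); p \<in> X \<rightarrow>\<^sub>E {0..1}\<rbrakk> \<Longrightarrow>
    expect_mult X h p = h (\<lambda>k\<in>expect X. k p)"
  by (simp add: expect_mult_def)

text \<open>This is the map of a module into its double dual. Both \<open>expect_mult X h\<close>
  and \<open>act (states M) h\<close> are \<open>h\<close> after an instance of it, so that both are
  seen to be homomorphisms.\<close>

lemma evaluation_hom:
  assumes "effect_module M"
    and S: "\<And>k. k \<in> S \<Longrightarrow> k \<in> emod_hom M unit_interval"
  shows "(\<lambda>y\<in>carrier M. \<lambda>k\<in>S. k y) \<in> emod_hom M (power_module S)"
proof (rule emod_homI)
  interpret effect_module M by fact
  show "(\<lambda>y\<in>carrier M. \<lambda>k\<in>S. k y) \<in> carrier M \<rightarrow>\<^sub>E carrier (power_module S)"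
    using emod_hom_closed[OF S] by auto
  show "(\<lambda>y\<in>carrier M. \<lambda>k\<in>S. k y) (eone M) = eone (power_module S)"
    using emod_hom_one[OF S] one_closed by (auto simp: fun_eq_iff)
  show "osum (power_module S) ((\<lambda>y\<in>carrier M. \<lambda>k\<in>S. k y) x) ((\<lambda>y\<in>carrier M. \<lambda>k\<in>S. k y) y)
      = Some ((\<lambda>y\<in>carrier M. \<lambda>k\<in>S. k y) z)"
    if "x \<in> carrier M" "y \<in> carrier M" "osum M x y = Some z" for x y z
  proof -
    \<comment> \<open>The sum in the interval is \<open>Some\<close> only up to 1, so the
      homomorphism law of \<open>k\<close> yields the bound as well as the value; the bounds for all
      \<open>k\<close> make the pointwise sum defined.\<close>
    have "k x + k y \<le> 1" "k z = k x + k y" if "k \<in> S" for k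
      using emod_hom_osum[OF S[OF that] \<open>x \<in> carrier M\<close> \<open>y \<in> carrier M\<close> \<open>osum M x y = Some z\<close>]
      by (simp_all split: if_splits)
    then show ?thesis
      using that osum_closed[OF that] by (simp cong: restrict_cong)
  qed
  show "(\<lambda>y\<in>carrier M. \<lambda>k\<in>S. k y) (scale M r x) =
      scale (power_module S) r ((\<lambda>y\<in>carrier M. \<lambda>k\<in>S. k y) x)"
    if "r \<in> {0..1}" "x \<in> carrier M" for r x
    using emod_hom_scale[OF S that] that scale_closed[OF that] by (auto simp: fun_eq_iff)
qed

lemma expect_mult_closed:
  assumes h: "h \<in> expect (expect X)"
  shows "expect_mult X h \<in> expect X"
proof -
  have "(\<lambda>p\<in>carrier (power_module X). \<lambda>k\<in>expect X. k p)
      \<in> emod_hom (power_module X) (power_module (expect X))"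
    by (rule evaluation_hom[OF effect_module_power_module]) (simp add: expect_def)
  \<comment> \<open>Only the outer \<open>expect\<close> is unfolded; the inner one stays as the
    index set of the power module.\<close>
  from emod_hom_compose[OF effect_module_power_module this h[unfolded expect_def[of "expect X"]]]
  have "compose (X \<rightarrow>\<^sub>E {0..1}) h (\<lambda>p\<in>X \<rightarrow>\<^sub>E {0..1}. \<lambda>k\<in>expect X. k p)
      \<in> emod_hom (power_module X) unit_interval"
    by (simp only: power_module_simps(1))
  moreover have "expect_mult X h =
      compose (X \<rightarrow>\<^sub>E {0..1}) h (\<lambda>p\<in>X \<rightarrow>\<^sub>E {0..1}. \<lambda>k\<in>expect X. k p)"
    unfolding expect_mult_def compose_def restrict_apply'[OF h] by (rule restrict_ext) simp
  ultimately show ?thesis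
    by (simp only: expect_def[of X])
qed

section \<open>The interval as an algebra and the predicates functor\<close>

lemma interval_alg_simps [simp]:
  "points interval_alg = {0..1}"
  "h \<in> expect {0..1} \<Longrightarrow> act interval_alg h = h (\<lambda>x\<in>{0..1}. x)"
  by (simp_all add: interval_alg_def)

lemma expectation_algebra_interval_alg: "expectation_algebra interval_alg"
proof
  show act: "act interval_alg \<in> expect (points interval_alg) \<rightarrow>\<^sub>E points interval_alg"
    using expect_range[of _ "{0..1}" "\<lambda>x\<in>{0..1}. x"] by (auto simp: interval_alg_def)
  show "act interval_alg (expect_unit (points interval_alg) x) = x"
    if "x \<in> points interval_alg" for x
  proof -
    have "(\<lambda>x\<in>{0..1}. x) \<in> {0..1} \<rightarrow>\<^sub>E {0..1::real}" by auto
    then show ?thesis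
      using that expect_unit_closed[of x "{0..1}"]
      by (simp add: expect_unit_def del: restrict_PiE)
  qed
  show "act interval_alg (expect_map (expect (points interval_alg)) (points interval_alg)
      (act interval_alg) h) = act interval_alg (expect_mult (points interval_alg) h)"
    if "h \<in> expect (expect (points interval_alg))" for h
  proof -
    have h: "h \<in> expect (expect {0..1})" using that by simp
    have *: "(\<lambda>x\<in>{0..1}. x) \<in> {0..1} \<rightarrow>\<^sub>E {0..1::real}" by auto
    \<comment> \<open>Both sides of the multiplication law become \<open>h\<close> applied to the
      function sending \<open>k\<close> to its value at the identity: the left side by this
      equation, the right side by \<open>expect_mult_apply\<close>.\<close>
    have "compose (expect {0..1}) (\<lambda>x\<in>{0..1}. x) (act interval_alg) =
        (\<lambda>k\<in>expect {0..1}. k (\<lambda>x\<in>{0..1}. x))"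
      unfolding compose_def using expect_range[OF _ *] by (intro restrict_ext) (simp del: restrict_PiE)
    moreover have "expect_map (expect {0..1}) {0..1} (act interval_alg) h \<in> expect {0..1}"
      using act by (intro expect_map_closed[OF _ h]) auto
    ultimately show ?thesis
      using expect_mult_closed[OF h] expect_map_apply[OF h *] expect_mult_apply[OF h *]
      by (simp del: restrict_PiE)
  qed
qed

text \<open>Evaluating the pushforward of \<open>h\<close> along \<open>p\<close> at the identity
  gives \<open>h\<close> of the identity after \<open>p\<close>, hence \<open>h p\<close>. In this
  form \<open>act interval_alg\<close> and \<open>expect_map\<close> are gone from the homomorphism
  law.\<close>

lemma alg_hom_interval_alg_iff:
  "p \<in> alg_hom A interval_alg \<longleftrightarrow>
    p \<in> points A \<rightarrow>\<^sub>E {0..1} \<and> (\<forall>h\<in>expect (points A). p (act A h) = h p)"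
proof -
  have "act interval_alg (expect_map (points A) {0..1} p h) = h p"
    if p: "p \<in> points A \<rightarrow>\<^sub>E {0..1}" and h: "h \<in> expect (points A)" for h
  proof -
    have "(\<lambda>x\<in>{0..1}. x) \<in> {0..1} \<rightarrow>\<^sub>E {0..1::real}" by auto
    moreover have "compose (points A) (\<lambda>x\<in>{0..1}. x) p = p"
      using p by (auto simp: compose_def fun_eq_iff PiE_iff Pi_iff extensional_def)
    moreover have "expect_map (points A) {0..1} p h \<in> expect {0..1}"
      using p by (intro expect_map_closed[OF _ h]) auto
    ultimately show ?thesis
      by (simp add: expect_map_apply[OF h] del: restrict_PiE)
  qed
  then show ?thesis
    by (auto simp: alg_hom_def)
qed

lemma predicates_simps [simp]:
  "carrier (predicates A) = alg_hom A interval_alg"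
  "osum (predicates A) = osum (power_module (points A))"
  "ezero (predicates A) = ezero (power_module (points A))"
  "orth (predicates A) = orth (power_module (points A))"
  "scale (predicates A) = scale (power_module (points A))"
  "eone (predicates A) = eone (power_module (points A))"
  by (simp_all add: predicates_def eone_def)

text \<open>Only closure remains. If \<open>p (act A h) = h p\<close>, then an operation applied to
  \<open>p\<close> takes at \<open>act A h\<close> the value of that operation at
  \<open>h p\<close>, and \<open>h\<close> preserves the operation.\<close>

lemma effect_module_predicates:
  assumes A: "expectation_algebra A"
  shows "effect_module (predicates A)"
proof -
  \<comment> \<open>The combined predicates are restricted to \<open>points A\<close>, so evaluating
    them at \<open>act A h\<close> requires this.\<close>
  have act: "act A h \<in> points A" if "h \<in> expect (points A)" for h
    using expectation_algebra.act_closed[OF A] that by auto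
  show ?thesis
    unfolding predicates_def
  proof (rule effect_module_pointwise)
    show "alg_hom A interval_alg \<subseteq> points A \<rightarrow>\<^sub>E {0..1}"
      by (simp add: subset_iff alg_hom_interval_alg_iff)
    show "(\<lambda>x\<in>points A. 0) \<in> alg_hom A interval_alg"
      by (auto simp: alg_hom_interval_alg_iff act expect_zero)
    show "(\<lambda>x\<in>points A. 1 - p x) \<in> alg_hom A interval_alg"
      if "p \<in> alg_hom A interval_alg" for p
      using that by (auto simp: alg_hom_interval_alg_iff act expect_orth dest: PiE_mem)
    show "(\<lambda>x\<in>points A. p x + q x) \<in> alg_hom A interval_alg"
      if "p \<in> alg_hom A interval_alg" "q \<in> alg_hom A interval_alg"
        "\<forall>x\<in>points A. p x + q x \<le> 1" for p q
      using that by (auto simp: alg_hom_interval_alg_iff act expect_add PiE_iff)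
    show "(\<lambda>x\<in>points A. r * p x) \<in> alg_hom A interval_alg"
      if "r \<in> {0..1}" "p \<in> alg_hom A interval_alg" for r p
      using that
      by (auto simp: alg_hom_interval_alg_iff act expect_scale PiE_iff intro: mult_le_one)
  qed
qed

text \<open>Moving \<open>act\<close> first past \<open>f\<close> and then past \<open>g\<close>
  leaves the pushforward of \<open>h\<close> along both maps in turn. With the interval as
  \<open>C\<close>, this keeps the values of \<open>predicates_map\<close> among the
  predicates.\<close>

lemma alg_hom_compose:
  assumes A: "expectation_algebra A"
    and f: "f \<in> alg_hom A B" and g: "g \<in> alg_hom B C"
  shows "compose (points A) g f \<in> alg_hom A C"
proof -
  have f_fun: "f \<in> points A \<rightarrow>\<^sub>E points B" and g_fun: "g \<in> points B \<rightarrow>\<^sub>E points C"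
    using f g by (auto simp: alg_hom_def)
  have "compose (points A) g f (act A h) =
      act C (expect_map (points A) (points C) (compose (points A) g f) h)"
    if h: "h \<in> expect (points A)" for h
  proof -
    have fh: "expect_map (points A) (points B) f h \<in> expect (points B)"
      using f_fun h by (intro expect_map_closed) auto
    \<comment> \<open>Functoriality of \<open>expect_map\<close> comes down to associativity of
      composition: a test function is pulled back along \<open>g\<close> and then along
      \<open>f\<close>.\<close>
    have "expect_map (points B) (points C) g (expect_map (points A) (points B) f h) =
        expect_map (points A) (points C) (compose (points A) g f) h"
    proof -
      have "compose (points B) p g \<in> points B \<rightarrow>\<^sub>E {0..1}" if "p \<in> points C \<rightarrow>\<^sub>E {0..1}" for p :: "_ \<Rightarrow> real"
        using that g_fun by (auto simp: compose_def PiE_iff Pi_iff)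
      moreover have "compose (points A) (compose (points B) p g) f =
          compose (points A) p (compose (points A) g f)" for p :: "_ \<Rightarrow> real"
        using f_fun by (auto simp: compose_def fun_eq_iff)
      ultimately show ?thesis
        unfolding expect_map_def[of "points B" "points C" g] expect_map_def[of "points A" "points C"]
        using h fh by (auto simp: expect_map_apply[OF h] intro!: restrict_ext)
    qed
    moreover have "act A h \<in> points A"
      using expectation_algebra.act_closed[OF A] h by auto
    ultimately show ?thesis
      using f g h fh by (simp add: compose_eq alg_hom_def)
  qed
  then show ?thesis
    using f_fun g_fun by (auto simp: alg_hom_def compose_def)
qed

section \<open>Action of the predicates functor on algebra homomorphisms\<close>

lemma predicates_map_hom:
  assumes A: "expectation_algebra A" and B: "expectation_algebra B"
    and f: "f \<in> alg_hom A B"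
  shows "predicates_map A B f \<in> emod_hom (predicates B) (predicates A)"
proof (rule emod_homI)
  interpret effect_module "predicates B"
    using B by (rule effect_module_predicates)
  have f_fun: "f x \<in> points B" if "x \<in> points A" for x
    using f that by (auto simp: alg_hom_def)
  show "predicates_map A B f \<in> carrier (predicates B) \<rightarrow>\<^sub>E carrier (predicates A)"
    using alg_hom_compose[OF A f] by (auto simp: predicates_map_def)
  show "predicates_map A B f (eone (predicates B)) = eone (predicates A)"
    using one_closed f_fun by (auto simp: predicates_map_def compose_def fun_eq_iff)
  show "osum (predicates A) (predicates_map A B f p) (predicates_map A B f q) =
      Some (predicates_map A B f z)"
    if "p \<in> carrier (predicates B)" "q \<in> carrier (predicates B)"
      "osum (predicates B) p q = Some z" for p q z
    using that osum_closed[OF that] f_fun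
    by (auto simp: predicates_map_def compose_def fun_eq_iff split: if_splits)
  show "predicates_map A B f (scale (predicates B) r p) =
      scale (predicates A) r (predicates_map A B f p)"
    if "r \<in> {0..1}" "p \<in> carrier (predicates B)" for r p
    using that scale_closed[OF that] f_fun
    by (auto simp: predicates_map_def compose_def fun_eq_iff)
qed

lemma predicates_map_id:
  "predicates_map A A (\<lambda>x\<in>points A. x) = (\<lambda>p\<in>carrier (predicates A). p)"
  by (auto simp: predicates_map_def compose_def fun_eq_iff alg_hom_interval_alg_iff
      PiE_iff extensional_def)

lemma predicates_map_compose:
  assumes f: "f \<in> alg_hom A B" and B: "expectation_algebra B" and g: "g \<in> alg_hom B C"
  shows "predicates_map A C (compose (points A) g f) =
    compose (carrier (predicates C)) (predicates_map A B f) (predicates_map B C g)"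
proof -
  have "f x \<in> points B" if "x \<in> points A" for x
    using f that by (auto simp: alg_hom_def)
  then show ?thesis
    using alg_hom_compose[OF B g] by (auto simp: predicates_map_def compose_def fun_eq_iff)
qed

section \<open>The states functor\<close>

lemma states_simps [simp]:
  "points (states M) = emod_hom M unit_interval"
  "h \<in> expect (emod_hom M unit_interval) \<Longrightarrow>
    act (states M) h = (\<lambda>y\<in>carrier M. h (\<lambda>k\<in>emod_hom M unit_interval. k y))"
  by (simp_all add: states_def Let_def)

lemma evaluation_closed:
  "y \<in> carrier M \<Longrightarrow> (\<lambda>k\<in>emod_hom M unit_interval. k y) \<in> emod_hom M unit_interval \<rightarrow>\<^sub>E {0..1}"
  by (auto dest: emod_hom_closed)

text \<open>As \<open>h\<close> after the evaluation map of \<open>M\<close>, it is a composite of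
  homomorphisms.\<close>

lemma states_act_closed:
  assumes M: "effect_module M" and h: "h \<in> expect (emod_hom M unit_interval)"
  shows "act (states M) h \<in> emod_hom M unit_interval"
proof -
  have "(\<lambda>y\<in>carrier M. \<lambda>k\<in>emod_hom M unit_interval. k y)
      \<in> emod_hom M (power_module (emod_hom M unit_interval))"
    by (rule evaluation_hom[OF M])
  from emod_hom_compose[OF M this h[unfolded expect_def]]
  show ?thesis
    using h by (simp add: compose_def cong: restrict_cong)
qed

text \<open>Evaluation at \<open>y\<close> composed with \<open>f\<close> is the function sending
  \<open>x\<close> to \<open>f x y\<close>. The multiplication law, the action on morphisms and both
  directions of transposition rest on this computation.\<close>

lemma states_act_expect_map:
  assumes f: "f \<in> X \<rightarrow> emod_hom M unit_interval" and h: "h \<in> expect X"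
  shows "act (states M) (expect_map X (emod_hom M unit_interval) f h) =
    (\<lambda>y\<in>carrier M. h (\<lambda>x\<in>X. f x y))"
proof -
  let ?S = "emod_hom M unit_interval"
  have "expect_map X ?S f h (\<lambda>k\<in>?S. k y) = h (\<lambda>x\<in>X. f x y)" if "y \<in> carrier M" for y
  proof -
    have "compose X (\<lambda>k\<in>?S. k y) f = (\<lambda>x\<in>X. f x y)"
      unfolding compose_def using f by (intro restrict_ext) (simp add: Pi_iff)
    then show ?thesis
      using expect_map_apply[OF h evaluation_closed[OF that], of f] by simp
  qed
  then show ?thesis
    using expect_map_closed[OF f h] by (simp cong: restrict_cong)
qed

text \<open>For the unit law, evaluating the evaluation at \<open>y\<close> in the point
  \<open>k\<close> gives \<open>k y\<close>. For the multiplication law, both sides send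
  \<open>y\<close> to \<open>h\<close> of the function taking \<open>k\<close> to its value at the
  evaluation at \<open>y\<close>.\<close>

lemma expectation_algebra_states:
  assumes M: "effect_module M"
  shows "expectation_algebra (states M)"
proof
  let ?S = "emod_hom M unit_interval"
  show act: "act (states M) \<in> expect (points (states M)) \<rightarrow>\<^sub>E points (states M)"
    using states_act_closed[OF M] by (auto simp: states_def Let_def extensional_def)
  show "act (states M) (expect_unit (points (states M)) k) = k" if "k \<in> points (states M)" for k
  proof -
    have "k \<in> carrier M \<rightarrow>\<^sub>E {0..1}"
      using that emod_hom_fun by fastforce
    then show ?thesis
      using that evaluation_closed[of _ M] expect_unit_closed[of k ?S]
      by (auto simp: expect_unit_def fun_eq_iff PiE_iff extensional_def simp del: restrict_PiE)
  qed
  show "act (states M) (expect_map (expect (points (states M))) (points (states M))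
      (act (states M)) h) = act (states M) (expect_mult (points (states M)) h)"
    if "h \<in> expect (expect (points (states M)))" for h
  proof -
    have h: "h \<in> expect (expect ?S)" using that by simp
    \<comment> \<open>The structure map itself is used as the family of states indexed by
      \<open>expect ?S\<close>.\<close>
    have "act (states M) (expect_map (expect ?S) ?S (act (states M)) h) =
        (\<lambda>y\<in>carrier M. h (\<lambda>k\<in>expect ?S. act (states M) k y))"
      using act by (intro states_act_expect_map h) auto
    also have "\<dots> = (\<lambda>y\<in>carrier M. h (\<lambda>k\<in>expect ?S. k (\<lambda>k\<in>?S. k y)))"
      by (simp cong: restrict_cong)
    also have "\<dots> = act (states M) (expect_mult ?S h)"
      using expect_mult_closed[OF h]
      by (simp add: expect_mult_apply[OF h evaluation_closed] cong: restrict_cong)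
    finally show ?thesis by simp
  qed
qed

section \<open>Action of the states functor on effect module homomorphisms\<close>

lemma states_map_hom:
  assumes M: "effect_module M" and N: "effect_module N" and g: "g \<in> emod_hom M N"
  shows "states_map M N g \<in> alg_hom (states N) (states M)"
proof -
  let ?S = "emod_hom M unit_interval" and ?T = "emod_hom N unit_interval"
  have closed: "states_map M N g \<in> ?T \<rightarrow>\<^sub>E ?S"
    using emod_hom_compose[OF M g] by (auto simp: states_map_def)
  have "states_map M N g (act (states N) h) = act (states M) (expect_map ?T ?S (states_map M N g) h)"
    if h: "h \<in> expect ?T" for h
  proof -
    \<comment> \<open>Both sides of the homomorphism law send \<open>y\<close> to \<open>h\<close>
      of the evaluation at \<open>g y\<close>.\<close>
    have "act (states M) (expect_map ?T ?S (states_map M N g) h) =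
        (\<lambda>y\<in>carrier M. h (\<lambda>k\<in>?T. states_map M N g k y))"
      using closed by (intro states_act_expect_map h) auto
    also have "\<dots> = (\<lambda>y\<in>carrier M. h (\<lambda>k\<in>?T. k (g y)))"
      by (simp add: states_map_def compose_eq cong: restrict_cong)
    also have "\<dots> = compose (carrier M) (act (states N) h) g"
      unfolding compose_def using h emod_hom_closed[OF g] by (intro restrict_ext) simp
    also have "\<dots> = states_map M N g (act (states N) h)"
      using states_act_closed[OF N h] by (simp only: states_map_def restrict_apply')
    finally show ?thesis by simp
  qed
  then show ?thesis
    using closed by (simp add: alg_hom_def)
qed

lemma states_map_id: "states_map M M (\<lambda>y\<in>carrier M. y) = (\<lambda>k\<in>points (states M). k)"
proof -
  have "compose (carrier M) k (\<lambda>y\<in>carrier M. y) = k" if "k \<in> emod_hom M unit_interval" for k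
    using emod_hom_fun[OF that] by (auto simp: compose_def fun_eq_iff PiE_iff extensional_def)
  then show ?thesis
    by (simp add: states_map_def cong: restrict_cong)
qed

lemma states_map_compose:
  assumes g: "g \<in> emod_hom M N" and N: "effect_module N" and h: "h \<in> emod_hom N K"
  shows "states_map M K (compose (carrier M) h g) =
    compose (points (states K)) (states_map M N g) (states_map N K h)"
proof -
  have "compose (carrier M) k (compose (carrier M) h g) =
      states_map M N g (states_map N K h k)" if k: "k \<in> emod_hom K unit_interval" for k
  proof -
    have "states_map M N g (states_map N K h k) = compose (carrier M) (compose (carrier N) k h) g"
      using k emod_hom_compose[OF N h k] by (simp add: states_map_def)
    also have "\<dots> = compose (carrier M) k (compose (carrier M) h g)"
      unfolding compose_def using emod_hom_closed[OF g] by (intro restrict_ext) simp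
    finally show ?thesis by simp
  qed
  then show ?thesis
    unfolding compose_def[of "points (states K)"] states_map_def[of M K]
    by (simp cong: restrict_cong)
qed

section \<open>Transposition\<close>

lemma emod_hom_predicatesD:
  assumes \<phi>: "\<phi> \<in> emod_hom M (predicates A)" and y: "y \<in> carrier M"
  shows "\<phi> y \<in> points A \<rightarrow>\<^sub>E {0..1}"
    and "h \<in> expect (points A) \<Longrightarrow> \<phi> y (act A h) = h (\<phi> y)"
    and "(\<lambda>x\<in>points A. \<phi> y x) = \<phi> y"
proof -
  have "\<phi> y \<in> alg_hom A interval_alg"
    using emod_hom_closed[OF \<phi> y] by simp
  then show *: "\<phi> y \<in> points A \<rightarrow>\<^sub>E {0..1}"
    and "h \<in> expect (points A) \<Longrightarrow> \<phi> y (act A h) = h (\<phi> y)"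
    by (simp_all add: alg_hom_interval_alg_iff)
  show "(\<lambda>x\<in>points A. \<phi> y x) = \<phi> y"
    using * by (rule PiE_restrict)
qed

text \<open>The operations of \<open>predicates A\<close> are pointwise, so each law for \<phi>,
  read at the single point \<open>x\<close>, is the corresponding law for the transpose.\<close>

lemma adj_transpose_point_closed:
  assumes M: "effect_module M" and \<phi>: "\<phi> \<in> emod_hom M (predicates A)" and x: "x \<in> points A"
  shows "adj_transpose A M \<phi> x \<in> emod_hom M unit_interval"
proof (rule emod_homI)
  interpret effect_module M by (rule M)
  show "adj_transpose A M \<phi> x \<in> carrier M \<rightarrow>\<^sub>E carrier unit_interval"
    using emod_hom_predicatesD(1)[OF \<phi>] x by (auto simp: adj_transpose_def PiE_iff)
  show "adj_transpose A M \<phi> x (eone M) = eone unit_interval"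
    using x one_closed emod_hom_one[OF \<phi>] by (simp add: adj_transpose_def)
  show "osum unit_interval (adj_transpose A M \<phi> x y) (adj_transpose A M \<phi> x z) =
      Some (adj_transpose A M \<phi> x w)"
    if "y \<in> carrier M" "z \<in> carrier M" "osum M y z = Some w" for y z w
  proof -
    have "\<forall>x\<in>points A. \<phi> y x + \<phi> z x \<le> 1" "\<phi> w = (\<lambda>x\<in>points A. \<phi> y x + \<phi> z x)"
      using emod_hom_osum[OF \<phi> that] by (simp_all split: if_splits)
    then show ?thesis
      using that x osum_closed[OF that] by (simp add: adj_transpose_def)
  qed
  show "adj_transpose A M \<phi> x (scale M r y) = scale unit_interval r (adj_transpose A M \<phi> x y)"
    if "r \<in> {0..1}" "y \<in> carrier M" for r y
    using emod_hom_scale[OF \<phi> that] that x scale_closed[OF that] by (simp add: adj_transpose_def)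
qed

text \<open>Read at \<open>y\<close>, the homomorphism law for the transpose says that \<phi>
  \<open>y\<close> at \<open>act A h\<close> is \<open>h\<close> of \<phi> \<open>y\<close>, which
  holds because \<phi> \<open>y\<close> is a homomorphism into the interval.\<close>

lemma adj_transpose_hom:
  assumes A: "expectation_algebra A" and M: "effect_module M"
    and \<phi>: "\<phi> \<in> emod_hom M (predicates A)"
  shows "adj_transpose A M \<phi> \<in> alg_hom A (states M)"
proof -
  let ?S = "emod_hom M unit_interval"
  have closed: "adj_transpose A M \<phi> \<in> points A \<rightarrow> ?S"
    using adj_transpose_point_closed[OF M \<phi>] by auto
  have "adj_transpose A M \<phi> (act A h) =
      act (states M) (expect_map (points A) ?S (adj_transpose A M \<phi>) h)"
    if h: "h \<in> expect (points A)" for h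
  proof -
    have "act A h \<in> points A"
      using expectation_algebra.act_closed[OF A] h by auto
    then have "adj_transpose A M \<phi> (act A h) = (\<lambda>y\<in>carrier M. h (\<phi> y))"
      using emod_hom_predicatesD(2)[OF \<phi> _ h]
      by (simp add: adj_transpose_def cong: restrict_cong)
    \<comment> \<open>Extensionality of \<phi> \<open>y\<close> allows it to be written as a family
      over \<open>points A\<close>, the shape that \<open>states_act_expect_map\<close>
      produces.\<close>
    also have "\<dots> = (\<lambda>y\<in>carrier M. h (\<lambda>x\<in>points A. adj_transpose A M \<phi> x y))"
      using emod_hom_predicatesD(3)[OF \<phi>]
      by (simp add: adj_transpose_def cong: restrict_cong)
    finally show ?thesis
      using states_act_expect_map[OF closed h] by simp
  qed
  then show ?thesis
    using closed by (simp add: alg_hom_def PiE_def adj_transpose_def)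
qed

lemma adj_transpose_inverse_hom:
  assumes A: "expectation_algebra A" and M: "effect_module M"
    and \<psi>: "\<psi> \<in> alg_hom A (states M)"
  shows "(\<lambda>y\<in>carrier M. \<lambda>x\<in>points A. \<psi> x y) \<in> emod_hom M (predicates A)"
    (is "?\<phi> \<in> _")
proof -
  interpret effect_module M by (rule M)
  have closed: "\<psi> x \<in> emod_hom M unit_interval" if "x \<in> points A" for x
    using \<psi> that by (auto simp: alg_hom_def)
  have "?\<phi> y \<in> alg_hom A interval_alg" if y: "y \<in> carrier M" for y
  proof -
    \<comment> \<open>The homomorphism law of \<psi> at the argument \<open>y\<close> is the
      condition in \<open>alg_hom_interval_alg_iff\<close> for the swapped map.\<close>
    have "\<psi> (act A h) y = h (\<lambda>x\<in>points A. \<psi> x y)" if h: "h \<in> expect (points A)" for h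
    proof -
      have "\<psi> (act A h) = (\<lambda>y\<in>carrier M. h (\<lambda>x\<in>points A. \<psi> x y))"
        using \<psi> h states_act_expect_map[OF _ h, of \<psi> M] closed by (simp add: alg_hom_def)
      then show ?thesis using y by simp
    qed
    moreover have "act A h \<in> points A" if "h \<in> expect (points A)" for h
      using expectation_algebra.act_closed[OF A] that by auto
    moreover have "\<psi> x y \<in> {0..1}" if "x \<in> points A" for x
      using emod_hom_closed[OF closed[OF that] y] by simp
    ultimately show ?thesis
      using y by (simp add: alg_hom_interval_alg_iff)
  qed
  then have fn: "?\<phi> \<in> carrier M \<rightarrow>\<^sub>E carrier (predicates A)"
    by (intro restrict_PiE_iff[THEN iffD2]) simp
  show ?thesis
  proof (rule emod_homI[OF fn])
    show "?\<phi> (eone M) = eone (predicates A)"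
      using one_closed emod_hom_one[OF closed] by (simp cong: restrict_cong)
    show "osum (predicates A) (?\<phi> y) (?\<phi> z) = Some (?\<phi> w)"
      if "y \<in> carrier M" "z \<in> carrier M" "osum M y z = Some w" for y z w
    proof -
      \<comment> \<open>The bound holds at every point, which is what definedness of the sum in
        \<open>predicates A\<close> requires.\<close>
      have "\<psi> x y + \<psi> x z \<le> 1 \<and> \<psi> x w = \<psi> x y + \<psi> x z" if "x \<in> points A" for x
        using emod_hom_osum[OF closed[OF that] \<open>y \<in> _\<close> \<open>z \<in> _\<close> \<open>osum M y z = _\<close>]
        by (simp split: if_splits)
      then show ?thesis
        using that osum_closed[OF that] by (simp cong: restrict_cong)
    qed
    show "?\<phi> (scale M r y) = scale (predicates A) r (?\<phi> y)"
      if "r \<in> {0..1}" "y \<in> carrier M" for r y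
      using that scale_closed[OF that] emod_hom_scale[OF closed that]
      by (simp cong: restrict_cong)
  qed
qed

lemma bij_betw_adj_transpose:
  assumes A: "expectation_algebra A" and M: "effect_module M"
  shows "bij_betw (adj_transpose A M) (emod_hom M (predicates A)) (alg_hom A (states M))"
proof (rule bij_betw_byWitness[where f' = "\<lambda>\<psi>. \<lambda>y\<in>carrier M. \<lambda>x\<in>points A. \<psi> x y"])
  show "\<forall>\<phi>\<in>emod_hom M (predicates A).
      (\<lambda>y\<in>carrier M. \<lambda>x\<in>points A. adj_transpose A M \<phi> x y) = \<phi>"
  proof
    fix \<phi> assume \<phi>: "\<phi> \<in> emod_hom M (predicates A)"
    \<comment> \<open>Swapping twice leaves \<phi> restricted in both arguments; extensionality of
      each \<phi> \<open>y\<close> removes the inner restriction, that of \<phi> the outer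
      one.\<close>
    have "(\<lambda>y\<in>carrier M. \<lambda>x\<in>points A. adj_transpose A M \<phi> x y) = (\<lambda>y\<in>carrier M. \<phi> y)"
      using emod_hom_predicatesD(3)[OF \<phi>] by (simp add: adj_transpose_def cong: restrict_cong)
    also have "\<dots> = \<phi>"
      using emod_hom_fun[OF \<phi>] by (simp only: PiE_restrict)
    finally show "(\<lambda>y\<in>carrier M. \<lambda>x\<in>points A. adj_transpose A M \<phi> x y) = \<phi>" .
  qed
  show "\<forall>\<psi>\<in>alg_hom A (states M).
      adj_transpose A M (\<lambda>y\<in>carrier M. \<lambda>x\<in>points A. \<psi> x y) = \<psi>"
  proof
    fix \<psi> assume "\<psi> \<in> alg_hom A (states M)"
    then have \<psi>: "\<psi> \<in> points A \<rightarrow>\<^sub>E emod_hom M unit_interval"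
      by (simp add: alg_hom_def)
    have "(\<lambda>y\<in>carrier M. \<psi> x y) = \<psi> x" if "x \<in> points A" for x
      using emod_hom_fun[OF PiE_mem[OF \<psi> that]] by (simp only: PiE_restrict)
    then have "adj_transpose A M (\<lambda>y\<in>carrier M. \<lambda>x\<in>points A. \<psi> x y) = (\<lambda>x\<in>points A. \<psi> x)"
      by (simp add: adj_transpose_def cong: restrict_cong)
    also have "\<dots> = \<psi>"
      using \<psi> by (simp only: PiE_restrict)
    finally show "adj_transpose A M (\<lambda>y\<in>carrier M. \<lambda>x\<in>points A. \<psi> x y) = \<psi>" .
  qed
qed (use adj_transpose_hom[OF A M] adj_transpose_inverse_hom[OF A M] in blast)+

section \<open>Naturality of transposition in the algebra and in the effect module\<close>

lemma adj_transpose_natural_alg: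
  assumes f: "f \<in> alg_hom A B" and \<phi>: "\<phi> \<in> emod_hom M (predicates B)"
  shows "adj_transpose A M (compose (carrier M) (predicates_map A B f) \<phi>) =
    compose (points A) (adj_transpose B M \<phi>) f"
proof -
  \<comment> \<open>Both sides send \<open>x\<close> and \<open>y\<close> to the value of \<phi>
    \<open>y\<close> at \<open>f x\<close>; membership of \<open>f x\<close> resolves the
    restriction in the transpose over \<open>B\<close>.\<close>
  have "f x \<in> points B" if "x \<in> points A" for x
    using f that by (auto simp: alg_hom_def)
  then show ?thesis
    using emod_hom_closed[OF \<phi>]
    by (simp add: adj_transpose_def compose_def predicates_map_def cong: restrict_cong)
qed

lemma adj_transpose_natural_emod:
  assumes N: "effect_module N" and g: "g \<in> emod_hom M N"
    and \<phi>: "\<phi> \<in> emod_hom N (predicates A)"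
  shows "adj_transpose A M (compose (carrier M) \<phi> g) =
    compose (points A) (states_map M N g) (adj_transpose A N \<phi>)"
proof -
  have "(\<lambda>y\<in>carrier M. compose (carrier M) \<phi> g y x) = states_map M N g (adj_transpose A N \<phi> x)"
    if x: "x \<in> points A" for x
  proof -
    \<comment> \<open>Since \<open>states_map\<close> is restricted to the states of
      \<open>N\<close>, the transpose at \<open>x\<close> must first be known to be one. Both sides
      then send \<open>y\<close> to the value of \<phi> \<open>(g y)\<close> at
      \<open>x\<close>.\<close>
    have "states_map M N g (adj_transpose A N \<phi> x) = compose (carrier M) (adj_transpose A N \<phi> x) g"
      using adj_transpose_point_closed[OF N \<phi> x] by (simp add: states_map_def)
    also have "\<dots> = (\<lambda>y\<in>carrier M. compose (carrier M) \<phi> g y x)"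
      unfolding compose_def[of _ "adj_transpose A N \<phi> x"]
      using x emod_hom_closed[OF g] by (intro restrict_ext) (simp add: adj_transpose_def compose_eq)
    finally show ?thesis by simp
  qed
  then show ?thesis
    unfolding compose_def[of "points A"] adj_transpose_def[of A M] by (rule restrict_ext)
qed

text \<open>The three modules and three algebras have independent types, because functoriality and
  naturality relate objects whose carriers live in different types.\<close>

theorem proposition36:
  fixes M :: "'m effect_mod" and N :: "'n effect_mod" and K :: "'k effect_mod"
    and A :: "'x expect_alg" and B :: "'y expect_alg" and C :: "'z expect_alg"
  assumes "effect_module M" and "effect_module N" and "effect_module K"
    and "expectation_algebra A" and "expectation_algebra B" and "expectation_algebra C"
  shows
    \<comment> \<open>the states functor from the opposite of EMod to Alg\<close>
    "(expectation_algebra (states M) \<and>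
      (\<forall>g\<in>emod_hom M N. states_map M N g \<in> alg_hom (states N) (states M)) \<and>
      states_map M M (\<lambda>y\<in>carrier M. y) = (\<lambda>k\<in>points (states M). k) \<and>
      (\<forall>g\<in>emod_hom M N. \<forall>h\<in>emod_hom N K.
        states_map M K (compose (carrier M) h g)
          = compose (points (states K)) (states_map M N g) (states_map N K h))) \<and>
     \<comment> \<open>the functor from Alg to the opposite of EMod given by homming into the interval\<close>
     (expectation_algebra interval_alg \<and>
      effect_module (predicates A) \<and>
      (\<forall>f\<in>alg_hom A B. predicates_map A B f \<in> emod_hom (predicates B) (predicates A)) \<and>
      predicates_map A A (\<lambda>x\<in>points A. x) = (\<lambda>p\<in>carrier (predicates A). p) \<and>
      (\<forall>f\<in>alg_hom A B. \<forall>g\<in>alg_hom B C.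
        predicates_map A C (compose (points A) g f)
          = compose (carrier (predicates C)) (predicates_map A B f) (predicates_map B C g))) \<and>
     \<comment> \<open>the bijection of hom-sets, natural in the algebra and in the effect module\<close>
     (bij_betw (adj_transpose A M) (emod_hom M (predicates A)) (alg_hom A (states M)) \<and>
      (\<forall>f\<in>alg_hom A B. \<forall>\<phi>\<in>emod_hom M (predicates B).
        adj_transpose A M (compose (carrier M) (predicates_map A B f) \<phi>)
          = compose (points A) (adj_transpose B M \<phi>) f) \<and>
      (\<forall>g\<in>emod_hom M N. \<forall>\<phi>\<in>emod_hom N (predicates A).
        adj_transpose A M (compose (carrier M) \<phi> g)
          = compose (points A) (states_map M N g) (adj_transpose A N \<phi>)))"
  using assms
  by (intro conjI ballI expectation_algebra_states states_map_hom states_map_id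
      states_map_compose expectation_algebra_interval_alg effect_module_predicates
      predicates_map_hom predicates_map_id predicates_map_compose bij_betw_adj_transpose
      adj_transpose_natural_alg adj_transpose_natural_emod)

end
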